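(* Let $H$ be a compound graph with base graph $G$, whose base edges carry weights in an integral domain $R$, and let $\operatorname{sgn}\in S(H)$ be any sign function on $H$ that respects the equivalence relation on base edges. Let $\overline{H}$ be the corresponding sign-weighted compound graph. Then $\#G$ divides $\#\overline{H}$ in $R$: $$\#G \mid \#\overline{H}.$$
   Context: All graphs are finite. For a graph $X$ with edge weights in an integral domain $R$, the weight of a perfect matching is the product of the weights of its edges, and $\#X$ denotes the sum of the weights of all perfect matchings of $X$. Compound graphs. Choose two planar bipartite graphs, the base graph $G$ (with a fixed planar embedding) and the supergraph, each with a black/white bipartite coloring; $G$ must have equally many black and white vertices. A compound graph $H$ is obtained as follows. (1) Place a copy of $G$ (with its coloring) at each vertex of the supergraph; copies at black vertices of the supergraph keep the original embedding of $G$, copies at white vertices get the reflected embedding. The copies are placed outside of each other, so that all inner faces of each copy are preserved. The vertices and edges of the copies are called base vertices and base edges. Two base vertices (respectively base edges) are equivalent, written $\cong$, if they correspond to the same vertex (respectively edge) of $G$. The "outer face" of a copy means the original outer face of $G$. (2) For each edge of the supergraph, with endpoints corresponding to copies $G_1,G_2$, one may add one or more new vertices called stems. Each stem is joined to exactly one vertex on the outer face of $G_1$ and exactly one vertex on the outer face of $G_2$, and these two vertices must be equivalent. All stems are colored black, so they are joined to white base vertices. (3) If $p$ stems were added in total, add $p$ new vertices called leaves, each of degree 1 and joined to a black base vertex on the outer face of some copy of $G$. All leaves are colored white. The resulting graph must be planar, and is drawn in the plane with the stems and leaves outside of all copies of the base graph, so that the inner faces of the copies are preserved; otherwise any planar embedding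 of the stems and leaves may be chosen. Weights. $G$ has edge weights in $R$; each base edge of $H$ has the weight of the corresponding edge of $G$; each edge incident to a stem or a leaf has weight $1$. Sign functions. For a bipartite graph embedded in the plane with edge set $E$, a sign function is a function $\operatorname{sgn}\colon E\to\{1,-1\}$ such that for every simple cycle $\mathcal C$ of length $2\ell$ that strictly encloses an even number of vertices, $\prod_{e\in\mathcal C}\operatorname{sgn} e=(-1)^{\ell-1}$. For a compound graph $H$, $S(H)$ denotes the set of sign functions on $H$ that respect the equivalence relation, i.e. $\operatorname{sgn} e_1=\operatorname{sgn} e_2$ whenever $e_1\cong e_2$ are equivalent base edges. Sign-weighting. Given $\operatorname{sgn}\in S(H)$, the sign-weighted compound graph $\overline{H}$ is the graph $H$ in which the weight of each edge $e$ incident to a stem or a leaf is multiplied by $\operatorname{sgn} e$ (weights of base edges are unchanged). *)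

theory Defs
  imports "HOL-Analysis.Analysis"
begin

section \<open>Bipartite graphs and perfect matchings\<close>

text \<open>
  Graphs are finite; parallel edges are allowed, so simple graphs are included as the case
  where the endpoint map is injective on the edges. The colouring is part of the data.
\<close>

record ('v, 'e) bigraph =
  blacks :: "'v set"
  whites :: "'v set"
  edges :: "'e set"
  ends :: "'e \<Rightarrow> 'v set"

definition verts :: "('v, 'e) bigraph \<Rightarrow> 'v set" where
  "verts X = blacks X \<union> whites X"

definition finite_bigraph :: "('v, 'e) bigraph \<Rightarrow> bool" where
  "finite_bigraph X \<longleftrightarrow>
     finite (blacks X) \<and> finite (whites X) \<and> finite (edges X) \<and>
     blacks X \<inter> whites X = {} \<and>
     (\<forall>e\<in>edges X. \<exists>b\<in>blacks X. \<exists>u\<in>whites X. ends X e = {b, u})"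

definition perfect_matching :: "('v, 'e) bigraph \<Rightarrow> 'e set \<Rightarrow> bool" where
  "perfect_matching X M \<longleftrightarrow> M \<subseteq> edges X \<and> (\<forall>v\<in>verts X. \<exists>!e. e \<in> M \<and> v \<in> ends X e)"

text \<open>The quantity written \<open>#X\<close>.\<close>

definition matching_sum :: "('v, 'e) bigraph \<Rightarrow> ('e \<Rightarrow> 'r::idom) \<Rightarrow> 'r" where
  "matching_sum X w = (\<Sum>M | perfect_matching X M. \<Prod>e\<in>M. w e)"

text \<open>
  A simple cycle, given by its cyclic lists of vertices and edges. Two parallel edges
  form a cycle of length 2.
\<close>

definition simple_cycle :: "('v, 'e) bigraph \<Rightarrow> 'v list \<Rightarrow> 'e list \<Rightarrow> bool" where
  "simple_cycle X vs es \<longleftrightarrow>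
     length es = length vs \<and> length es \<ge> 2 \<and> distinct vs \<and> distinct es \<and>
     set vs \<subseteq> verts X \<and> set es \<subseteq> edges X \<and>
     (\<forall>i<length es. ends X (es ! i) = {vs ! i, vs ! (Suc i mod length vs)})"


section \<open>Drawings in the plane\<close>

text \<open>The plane is \<^typ>\<open>complex\<close>; an edge is drawn as a point set, the image of an arc.\<close>

record ('v, 'e) drawing =
  point :: "'v \<Rightarrow> complex"
  curve :: "'e \<Rightarrow> complex set"

definition drawn :: "('v, 'e) bigraph \<Rightarrow> ('v, 'e) drawing \<Rightarrow> complex set" where
  "drawn X D = point D ` verts X \<union> (\<Union>e\<in>edges X. curve D e)"

definition plane_drawing :: "('v, 'e) bigraph \<Rightarrow> ('v, 'e) drawing \<Rightarrow> bool" where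
  "plane_drawing X D \<longleftrightarrow>
     inj_on (point D) (verts X) \<and>
     (\<forall>e\<in>edges X. \<exists>g. arc g \<and> path_image g = curve D e \<and>
        {pathstart g, pathfinish g} = point D ` ends X e) \<and>
     (\<forall>e\<in>edges X. curve D e \<inter> point D ` verts X = point D ` ends X e) \<and>
     (\<forall>e\<in>edges X. \<forall>e'\<in>edges X. e \<noteq> e' \<longrightarrow>
        curve D e \<inter> curve D e' = point D ` (ends X e \<inter> ends X e'))"

definition planar :: "('v, 'e) bigraph \<Rightarrow> bool" where
  "planar X \<longleftrightarrow> (\<exists>D. plane_drawing X D)"

text \<open>For a bounded set \<open>A\<close> of the plane, \<^term>\<open>outside A\<close> is the unbounded component of
  the complement and \<^term>\<open>inside A\<close> the union of the bounded ones.\<close>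

definition on_outer_face :: "('v, 'e) bigraph \<Rightarrow> ('v, 'e) drawing \<Rightarrow> 'v \<Rightarrow> bool" where
  "on_outer_face X D v \<longleftrightarrow> v \<in> verts X \<and> point D v \<in> frontier (outside (drawn X D))"

definition enclosed :: "('v, 'e) bigraph \<Rightarrow> ('v, 'e) drawing \<Rightarrow> 'e list \<Rightarrow> 'v set" where
  "enclosed X D es = {v \<in> verts X. point D v \<in> inside (\<Union>e\<in>set es. curve D e)}"

definition sign_function :: "('v, 'e) bigraph \<Rightarrow> ('v, 'e) drawing \<Rightarrow> ('e \<Rightarrow> int) \<Rightarrow> bool" where
  "sign_function X D \<sigma> \<longleftrightarrow>
     (\<forall>e\<in>edges X. \<sigma> e \<in> {1, -1}) \<and>
     (\<forall>vs es l. simple_cycle X vs es \<and> length es = 2 * l \<and> even (card (enclosed X D es)) \<longrightarrow>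
        (\<Prod>e\<in>set es. \<sigma> e) = (- 1) ^ (l - 1))"

text \<open>
  \<open>isotopic f g\<close>: the maps \<open>f\<close> and \<open>g\<close> are joined by a path of homeomorphisms of the
  plane. Two drawings represent the same plane embedding if a homeomorphism isotopic to the
  identity carries one to the other, and reflected embeddings if one isotopic to complex
  conjugation does.
\<close>

definition isotopic :: "(complex \<Rightarrow> complex) \<Rightarrow> (complex \<Rightarrow> complex) \<Rightarrow> bool" where
  "isotopic = homotopic_with_canon (\<lambda>h. \<exists>k. homeomorphism UNIV UNIV h k) UNIV UNIV"


section \<open>Compound graphs\<close>

text \<open>
  The stem \<open>t\<close> belongs to the edge \<open>stem_edge t\<close> of the supergraph and is joined, in both
  copies at the ends of that edge, to the base vertex corresponding to \<open>stem_foot t\<close>; in this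
  way its two neighbours are equivalent. The leaf \<open>l\<close> is joined to the vertex corresponding
  to \<open>leaf_foot l\<close> in the copy at \<open>leaf_copy l\<close>.
\<close>

record ('v, 'e, 's, 'f, 't, 'l) compound =
  base :: "('v, 'e) bigraph"
  base_drawing :: "('v, 'e) drawing"
  supergraph :: "('s, 'f) bigraph"
  stems :: "'t set"
  stem_edge :: "'t \<Rightarrow> 'f"
  stem_foot :: "'t \<Rightarrow> 'v"
  leaves :: "'l set"
  leaf_copy :: "'l \<Rightarrow> 's"
  leaf_foot :: "'l \<Rightarrow> 'v"

text \<open>
  The supergraph is required to have a vertex: with no copy of the base graph at all,
  the compound graph would be the empty graph.
\<close>

definition compound_data :: "('v, 'e, 's, 'f, 't, 'l) compound \<Rightarrow> bool" where
  "compound_data C \<longleftrightarrow>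
     finite_bigraph (base C) \<and>
     card (blacks (base C)) = card (whites (base C)) \<and>
     plane_drawing (base C) (base_drawing C) \<and>
     finite_bigraph (supergraph C) \<and> planar (supergraph C) \<and> verts (supergraph C) \<noteq> {} \<and>
     finite (stems C) \<and>
     (\<forall>t\<in>stems C. stem_edge C t \<in> edges (supergraph C) \<and>
        stem_foot C t \<in> whites (base C) \<and>
        on_outer_face (base C) (base_drawing C) (stem_foot C t)) \<and>
     finite (leaves C) \<and> card (leaves C) = card (stems C) \<and>
     (\<forall>l\<in>leaves C. leaf_copy C l \<in> verts (supergraph C) \<and>
        leaf_foot C l \<in> blacks (base C) \<and>
        on_outer_face (base C) (base_drawing C) (leaf_foot C l))"

text \<open>
  \<open>BaseV s v\<close> and \<open>BaseE s e\<close> are the copies of \<open>v\<close> and \<open>e\<close> at the vertex \<open>s\<close> of the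
  supergraph; \<open>StemE t s\<close> joins the stem \<open>t\<close> to the copy at \<open>s\<close>.
\<close>

datatype ('v, 's, 't, 'l) cvert = BaseV 's 'v | Stem 't | Leaf 'l

datatype ('e, 's, 't, 'l) cedge = BaseE 's 'e | StemE 't 's | LeafE 'l

fun cends :: "('v, 'e, 's, 'f, 't, 'l) compound \<Rightarrow>
    ('e, 's, 't, 'l) cedge \<Rightarrow> ('v, 's, 't, 'l) cvert set" where
  "cends C (BaseE s e) = BaseV s ` ends (base C) e"
| "cends C (StemE t s) = {Stem t, BaseV s (stem_foot C t)}"
| "cends C (LeafE l) = {Leaf l, BaseV (leaf_copy C l) (leaf_foot C l)}"

definition compound_graph :: "('v, 'e, 's, 'f, 't, 'l) compound \<Rightarrow>
    (('v, 's, 't, 'l) cvert, ('e, 's, 't, 'l) cedge) bigraph" where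
  "compound_graph C =
     \<lparr> blacks = {BaseV s v |s v. s \<in> verts (supergraph C) \<and> v \<in> blacks (base C)} \<union> Stem ` stems C,
       whites = {BaseV s v |s v. s \<in> verts (supergraph C) \<and> v \<in> whites (base C)} \<union> Leaf ` leaves C,
       edges = {BaseE s e |s e. s \<in> verts (supergraph C) \<and> e \<in> edges (base C)} \<union>
         {StemE t s |t s. t \<in> stems C \<and> s \<in> ends (supergraph C) (stem_edge C t)} \<union>
         LeafE ` leaves C,
       ends = cends C \<rparr>"

text \<open>The part of the plane covered by the copy of the base graph at \<open>s\<close>.\<close>

definition copy_drawn :: "('v, 'e, 's, 'f, 't, 'l) compound \<Rightarrow>
    (('v, 's, 't, 'l) cvert, ('e, 's, 't, 'l) cedge) drawing \<Rightarrow> 's \<Rightarrow> complex set" where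
  "copy_drawn C D s = (\<lambda>v. point D (BaseV s v)) ` verts (base C) \<union>
     (\<Union>e\<in>edges (base C). curve D (BaseE s e))"

text \<open>
  The last condition says that everything outside a given copy (the other copies, the stems
  and the leaves) is drawn in the outer face of that copy.
\<close>

definition compound_drawing :: "('v, 'e, 's, 'f, 't, 'l) compound \<Rightarrow>
    (('v, 's, 't, 'l) cvert, ('e, 's, 't, 'l) cedge) drawing \<Rightarrow> bool" where
  "compound_drawing C D \<longleftrightarrow>
     plane_drawing (compound_graph C) D \<and>
     (\<forall>s\<in>verts (supergraph C).
        \<exists>\<phi>. isotopic (if s \<in> blacks (supergraph C) then id else cnj) \<phi> \<and>
          (\<forall>v\<in>verts (base C). point D (BaseV s v) = \<phi> (point (base_drawing C) v)) \<and>
          (\<forall>e\<in>edges (base C). curve D (BaseE s e) = \<phi> ` curve (base_drawing C) e)) \<and>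
     (\<forall>s\<in>verts (supergraph C).
        drawn (compound_graph C) D - copy_drawn C D s \<subseteq> outside (copy_drawn C D s))"

fun edge_weight :: "('e \<Rightarrow> 'r::idom) \<Rightarrow> ('e, 's, 't, 'l) cedge \<Rightarrow> 'r" where
  "edge_weight w (BaseE s e) = w e"
| "edge_weight w (StemE t s) = 1"
| "edge_weight w (LeafE l) = 1"

text \<open>The set \<open>S(H)\<close>.\<close>

definition respectful_signs :: "('v, 'e, 's, 'f, 't, 'l) compound \<Rightarrow>
    (('v, 's, 't, 'l) cvert, ('e, 's, 't, 'l) cedge) drawing \<Rightarrow>
    (('e, 's, 't, 'l) cedge \<Rightarrow> int) set" where
  "respectful_signs C D = {\<sigma>. sign_function (compound_graph C) D \<sigma> \<and>
     (\<forall>s\<in>verts (supergraph C). \<forall>s'\<in>verts (supergraph C). \<forall>e\<in>edges (base C).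
        \<sigma> (BaseE s e) = \<sigma> (BaseE s' e))}"

definition sign_weight :: "(('e, 's, 't, 'l) cedge \<Rightarrow> int) \<Rightarrow> ('e \<Rightarrow> 'r::idom) \<Rightarrow>
    ('e, 's, 't, 'l) cedge \<Rightarrow> 'r" where
  "sign_weight \<sigma> w x =
     (case x of BaseE s e \<Rightarrow> edge_weight w x | _ \<Rightarrow> of_int (\<sigma> x) * edge_weight w x)"

end

theory Submission
  imports Defs "HOL-Combinatorics.Cycles" "Jordan_Normal_Form.Determinant"
begin

text \<open>
  Let \<open>A\<close> be the matrix with rows indexed by the black vertices of \<open>G\<close> and columns by its white
  ones, whose entries are the weights multiplied by the signs (summed over parallel edges), and
  let \<open>K\<close> be the matrix built in the same way from the sign-weighted graph \<open>H\<close>. The proof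
  compares their determinants.

  By an argument of Kasteleyn, a sign function makes all terms of the Leibniz expansion carry the
  same sign, so that \<open>det A = \<plusminus>#G\<close> and \<open>det K\<close> is \<open>\<plusminus>\<close> the matching sum of the sign-weighted
  \<open>H\<close> (\<open>det_eq_matching_sum\<close>). Indeed two perfect matchings differ by disjoint alternating
  cycles. Such a cycle encloses an even number of vertices, because an edge of either matching
  cannot cross it and so the enclosed vertices are matched with each other. Hence the product of
  the signs along a cycle of length \<open>2l\<close> is \<open>(-1)^(l-1)\<close>, which is also the sign of the
  cyclic permutation of its \<open>l\<close> black vertices. For \<open>G\<close> the signs are those of one copy inside
  \<open>H\<close>; as everything else is drawn in the outer face of that copy, a cycle of the copy encloses
  the same vertices in \<open>G\<close> and in \<open>H\<close> (\<open>sign_function_copy\<close>).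

  It remains to see that \<open>det A\<close> divides \<open>det K\<close>. Equivalent base edges have equal signs, so
  every copy of \<open>G\<close> contributes the same block \<open>A\<close> to \<open>K\<close>. A stem edge has weight \<open>\<sigma>\<close> in
  the sign-weighted graph, and its entry in \<open>K\<close> is therefore \<open>\<sigma> * \<sigma> = 1\<close>. Now add up the
  columns of the copies of a white base vertex, with sign \<open>+1\<close> for copies at black and \<open>-1\<close> for
  copies at white vertices of the supergraph. In the row of a stem the two entries cancel, since
  the stem meets equivalent vertices of two copies of opposite colour. In the rows of a copy, what
  is left is \<open>\<plusminus>A\<close>. So \<open>K Z = R A\<close> for the matrix \<open>Z\<close> of this column operation and some
  matrix \<open>R\<close>, and since \<open>Z\<close> contains an identity block, \<open>det A\<close> divides \<open>det K\<close>
  (\<open>det_dvd_det_of_column_combination\<close>).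
\<close>

section \<open>Signs of permutations and divisibility of determinants\<close>

lemma sign_cycle_of_list:
  assumes "distinct cs" "cs \<noteq> []"
  shows "sign (cycle_of_list cs) = (- 1) ^ (length cs - 1)"
  using assms
proof (induction cs rule: cycle_of_list.induct)
  case (1 i j cs)
  have "sign (Transposition.transpose i j \<circ> cycle_of_list (j # cs)) =
      sign (Transposition.transpose i j) * sign (cycle_of_list (j # cs))"
    by (rule sign_compose) (simp_all add: permutation_swap_id permutation_of_cycle)
  then show ?case using 1 by (simp add: sign_swap_id comp_def)
qed simp_all

lemma cycle_of_list_nth:
  assumes "distinct cs" "k < length cs"
  shows "cycle_of_list cs (cs ! k) = cs ! (Suc k mod length cs)"
proof -
  have "map (cycle_of_list cs) cs = rotate1 cs"
    using cyclic_rotation[OF assms(1), of 1] by simp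
  then have "map (cycle_of_list cs) cs ! k = rotate1 cs ! k" by simp
  with assms(2) show ?thesis by (simp add: nth_rotate1)
qed

text \<open>
  Signs are multiplicative over the disjoint cycles of \<open>p\<close>, and a cycle of length \<open>l\<close> has sign
  \<open>(-1)^(l-1)\<close>. Fixed points are cycles of length 1, so the hypothesis on \<open>g\<close> covers them too.
\<close>

lemma sign_eq_prod_over_cycles:
  assumes "p permutes S" "finite S"
    and "\<And>cs. \<lbrakk>distinct cs; cs \<noteq> []; set cs \<subseteq> S;
      \<And>k. k < length cs \<Longrightarrow> p (cs ! k) = cs ! (Suc k mod length cs)\<rbrakk> \<Longrightarrow>
      (\<Prod>i\<in>set cs. g i) = (- 1) ^ (length cs - 1)"
  shows "sign p = (\<Prod>i\<in>S. g i)"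
proof -
  have "cycle_decomp S p" using assms(1,2) by (rule cycle_decomposition)
  then have "finite S \<and> p permutes S \<and> sign p = (\<Prod>i\<in>S. g i)" using assms(3)
  proof (induction rule: cycle_decomp.induct)
    case empty
    show ?case using permutes_id[of "{}"] by (simp add: id_def)
  next
    case (comp I p cs)
    let ?c = "cycle_of_list cs"
    \<comment> \<open>The new cycle moves only its own elements, so the old cycles are still followed by the
      composite permutation and the hypothesis on \<open>g\<close> is inherited by \<open>p\<close>.\<close>
    have outside: "?c i = i" if "i \<notin> set cs" for i
      using that by (rule id_outside_supp)
    have "\<And>ds. \<lbrakk>distinct ds; ds \<noteq> []; set ds \<subseteq> I;
        \<And>k. k < length ds \<Longrightarrow> p (ds ! k) = ds ! (Suc k mod length ds)\<rbrakk> \<Longrightarrow>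
        (\<Prod>i\<in>set ds. g i) = (- 1) ^ (length ds - 1)"
    proof -
      fix ds assume ds: "distinct ds" "ds \<noteq> []" "set ds \<subseteq> I"
        "\<And>k. k < length ds \<Longrightarrow> p (ds ! k) = ds ! (Suc k mod length ds)"
      have "(?c \<circ> p) (ds ! k) = ds ! (Suc k mod length ds)" if "k < length ds" for k
      proof -
        have "ds ! (Suc k mod length ds) \<in> I"
          using ds(2,3) by (meson in_mono length_greater_0_conv mod_less_divisor nth_mem)
        then show ?thesis using comp.hyps(3) ds(4)[OF that] outside by auto
      qed
      then show "(\<Prod>i\<in>set ds. g i) = (- 1) ^ (length ds - 1)"
        using ds(1-3) by (intro comp.prems) auto
    qed
    then have IH: "finite I" "p permutes I" "sign p = (\<Prod>i\<in>I. g i)"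
      using comp.IH by blast+
    have fixed: "p i = i" if "i \<in> set cs" for i
      using IH(2) that comp.hyps(3) by (meson disjoint_iff permutes_not_in)
    have cyc: "(\<Prod>i\<in>set cs. g i) = sign ?c"
    proof (cases "cs = []")
      case False
      then show ?thesis using comp.hyps(2)
        by (subst comp.prems)
          (auto simp: sign_cycle_of_list fixed cycle_of_list_nth)
    qed simp
    have "permutation p" using IH(1,2) permutation_permutes by blast
    then have "sign (?c \<circ> p) = sign ?c * sign p"
      by (simp add: sign_compose permutation_of_cycle)
    also have "\<dots> = (\<Prod>i\<in>set cs \<union> I. g i)"
      using comp.hyps(3) IH cyc by (simp add: prod.union_disjoint)
    finally have "sign (?c \<circ> p) = (\<Prod>i\<in>set cs \<union> I. g i)" .
    moreover have "?c \<circ> p permutes set cs \<union> I"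
      using permutes_subset[OF IH(2)] permutes_subset[OF cycle_permutes[of cs]]
      by (intro permutes_compose) auto
    ultimately show ?case using IH(1) by (simp add: comp_def)
  qed
  then show ?thesis by simp
qed

text \<open>
  The hypotheses say \<open>K Z = R A\<close>, where the \<open>N * n\<close> matrix \<open>Z\<close> has the identity as its upper
  block. Completing \<open>Z\<close> by unit columns gives a unitriangular matrix, and completing \<open>A\<close> by an
  identity block gives a square matrix with the same determinant, so multiplicativity applies.
\<close>

lemma det_dvd_det_of_column_combination:
  fixes a k z r :: "nat \<Rightarrow> nat \<Rightarrow> 'r::idom"
  assumes "n \<le> N"
    and z: "\<And>i j. i < n \<Longrightarrow> j < n \<Longrightarrow> z i j = (if i = j then 1 else 0)"
    and kz: "\<And>i j. i < N \<Longrightarrow> j < n \<Longrightarrow> (\<Sum>l<N. k i l * z l j) = (\<Sum>l<n. r i l * a l j)"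
  shows "Determinant.det (mat n n (\<lambda>(i, j). a i j)) dvd Determinant.det (mat N N (\<lambda>(i, j). k i j))"
proof -
  define A where "A = mat n n (\<lambda>(i, j). a i j)"
  define K where "K = mat N N (\<lambda>(i, j). k i j)"
  define Z where "Z = mat N N (\<lambda>(i, j). if j < n then z i j else if i = j then 1 else 0)"
  define R where "R = mat N N (\<lambda>(i, j). if j < n then r i j else k i j)"
  define B where "B = mat N N (\<lambda>(i, j). if i < n \<and> j < n then a i j else if i = j then 1 else 0)"
  have detZ: "Determinant.det Z = 1"
  proof -
    have "Determinant.det Z = prod_list (diag_mat Z)"
      by (rule det_lower_triangular[of N]) (use assms(1) in \<open>auto simp: Z_def z\<close>)
    also have "diag_mat Z = map (\<lambda>_. 1) [0..<N]"
      by (auto simp: diag_mat_def Z_def z)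
    finally show ?thesis by (simp add: map_replicate_const)
  qed
  have detB: "Determinant.det B = Determinant.det A"
  proof -
    have "B = four_block_mat A (0\<^sub>m n (N - n)) (0\<^sub>m (N - n) n) (1\<^sub>m (N - n))"
      using assms(1) by (intro eq_matI) (auto simp: B_def A_def four_block_mat_def Let_def)
    then show ?thesis
      using det_four_block_mat_lower_left_zero[of A n "0\<^sub>m n (N - n)" "N - n" "0\<^sub>m (N - n) n" "1\<^sub>m (N - n)"]
      by (simp add: A_def)
  qed
  have "K * Z = R * B"
  proof (rule eq_matI)
    fix i j assume "i < dim_row (R * B)" "j < dim_col (R * B)"
    then have ij: "i < N" "j < N" by (simp_all add: R_def B_def)
    have entry: "(U * V) $$ (i, j) = (\<Sum>l<N. U $$ (i, l) * V $$ (l, j))"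
      if "U \<in> carrier_mat N N" "V \<in> carrier_mat N N" for U V :: "'r mat"
      using that ij by (auto simp: scalar_prod_def lessThan_atLeast0 intro!: sum.cong)
    have K: "(K * Z) $$ (i, j) = (\<Sum>l<N. k i l * Z $$ (l, j))"
      by (subst entry) (use ij in \<open>auto simp: K_def Z_def\<close>)
    have R: "(R * B) $$ (i, j) = (\<Sum>l<N. (if l < n then r i l else k i l) * B $$ (l, j))"
      by (subst entry) (use ij in \<open>auto simp: R_def B_def\<close>)
    show "(K * Z) $$ (i, j) = (R * B) $$ (i, j)"
    proof (cases "j < n")
      case True
      have "(R * B) $$ (i, j) = (\<Sum>l<N. if l < n then r i l * a l j else 0)"
        unfolding R by (rule sum.cong) (use True ij in \<open>auto simp: B_def\<close>)
      also have "\<dots> = (\<Sum>l<n. r i l * a l j)"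
        using assms(1) by (intro sum.mono_neutral_cong_right) auto
      also have "\<dots> = (\<Sum>l<N. k i l * z l j)"
        using kz[OF ij(1) True] by simp
      also have "\<dots> = (K * Z) $$ (i, j)"
        unfolding K by (rule sum.cong) (use True ij in \<open>auto simp: Z_def\<close>)
      finally show ?thesis by simp
    next
      case False
      have "(K * Z) $$ (i, j) = (\<Sum>l<N. if l = j then k i l else 0)"
        unfolding K by (rule sum.cong) (use False ij in \<open>auto simp: Z_def\<close>)
      moreover have "(R * B) $$ (i, j) = (\<Sum>l<N. if l = j then k i l else 0)"
        unfolding R by (rule sum.cong) (use False ij in \<open>auto simp: B_def\<close>)
      ultimately show ?thesis by simp
    qed
  qed (simp_all add: K_def Z_def R_def B_def)
  then have "Determinant.det K * Determinant.det Z = Determinant.det R * Determinant.det B"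
    using det_mult[of K N Z] det_mult[of R N B] by (simp add: K_def Z_def R_def B_def)
  then have "Determinant.det K = Determinant.det R * Determinant.det A"
    using detZ detB by simp
  then show ?thesis unfolding A_def K_def by simp
qed

section \<open>Plane drawings and sign functions\<close>

lemma sign_function_square:
  assumes "sign_function X D \<sigma>" "e \<in> edges X"
  shows "\<sigma> e * \<sigma> e = 1"
proof -
  have "\<sigma> e \<in> {1, - 1}" using assms by (simp add: sign_function_def)
  then show ?thesis by auto
qed

lemma sign_function_cycle:
  assumes "sign_function X D \<sigma>"
    and "simple_cycle X vs es" "length es = 2 * l" "even (card (enclosed X D es))"
  shows "(\<Prod>e\<in>set es. \<sigma> e) = (- 1) ^ (l - 1)"
proof -
  have "\<forall>vs es l. simple_cycle X vs es \<and> length es = 2 * l \<and> even (card (enclosed X D es)) \<longrightarrow>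
      (\<Prod>e\<in>set es. \<sigma> e) = (- 1) ^ (l - 1)"
    using assms(1) unfolding sign_function_def by (rule conjunct2)
  from this[rule_format, OF conjI, OF assms(2) conjI, OF assms(3,4)] show ?thesis .
qed

lemma connected_inside_iff:
  assumes "connected S" "S \<inter> \<Gamma> = {}" "x \<in> S" "y \<in> S"
  shows "x \<in> inside \<Gamma> \<longleftrightarrow> y \<in> inside \<Gamma>"
proof -
  have "S \<subseteq> - \<Gamma>" using assms(2) by auto
  then have xy: "connected_component (- \<Gamma>) x y"
    unfolding connected_component_def using assms(1,3,4) by (intro exI[of _ S]) simp
  then have yx: "connected_component (- \<Gamma>) y x" by (rule connected_component_sym)
  show ?thesis
    using inside_same_component[OF xy] inside_same_component[OF yx] by (rule iffI)
qed

lemma plane_drawing_arc: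
  assumes "plane_drawing X D" "e \<in> edges X"
  shows "\<exists>g. arc g \<and> path_image g = curve D e \<and> {pathstart g, pathfinish g} = point D ` ends X e"
proof -
  have "\<forall>e\<in>edges X. \<exists>g. arc g \<and> path_image g = curve D e \<and>
      {pathstart g, pathfinish g} = point D ` ends X e"
    using assms(1) unfolding plane_drawing_def by (elim conjE)
  then show ?thesis using assms(2) by (rule bspec)
qed

lemma curve_Int_points:
  assumes "plane_drawing X D" "e \<in> edges X"
  shows "curve D e \<inter> point D ` verts X = point D ` ends X e"
  using assms by (simp add: plane_drawing_def)

lemma curve_Int_curve:
  assumes "plane_drawing X D" "e \<in> edges X" "e' \<in> edges X" "e \<noteq> e'"
  shows "curve D e \<inter> curve D e' = point D ` (ends X e \<inter> ends X e')"
  using assms by (simp add: plane_drawing_def)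

lemma point_in_curve:
  assumes "plane_drawing X D" "e \<in> edges X" "v \<in> ends X e"
  shows "point D v \<in> curve D e"
  using curve_Int_points[OF assms(1,2)] assms(3) by (metis IntD1 imageI)

text \<open>
  The curve of an edge is connected. When the edge shares no end with the given edges, its curve
  is disjoint from theirs and stays in one component of the complement.
\<close>

lemma enclosed_iff_across_edge:
  assumes D: "plane_drawing X D" and e: "e \<in> edges X" "ends X e = {a, b}"
    and ab: "a \<in> verts X" "b \<in> verts X" and es: "set es \<subseteq> edges X"
    and avoid: "\<And>e'. e' \<in> set es \<Longrightarrow> ends X e \<inter> ends X e' = {}"
  shows "a \<in> enclosed X D es \<longleftrightarrow> b \<in> enclosed X D es"
proof -
  obtain g where g: "arc g" "path_image g = curve D e"
    "{pathstart g, pathfinish g} = point D ` ends X e"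
    using plane_drawing_arc[OF D e(1)] by blast
  have "connected (curve D e)"
    using g(1,2) by (metis arc_imp_path connected_path_image)
  moreover have "curve D e \<inter> (\<Union>e'\<in>set es. curve D e') = {}"
  proof -
    have "curve D e \<inter> curve D e' = {}" if "e' \<in> set es" for e'
    proof -
      have "e \<noteq> e'" using avoid[OF that] e(2) by auto
      moreover have "e' \<in> edges X" using es that by blast
      ultimately have "curve D e \<inter> curve D e' = point D ` (ends X e \<inter> ends X e')"
        using curve_Int_curve[OF D e(1)] by simp
      then show ?thesis unfolding avoid[OF that] by simp
    qed
    then show ?thesis by blast
  qed
  moreover have "point D a \<in> curve D e" "point D b \<in> curve D e"
    using point_in_curve[OF D e(1)] e(2) by simp_all
  ultimately have "point D a \<in> inside (\<Union>e'\<in>set es. curve D e') \<longleftrightarrow>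
      point D b \<in> inside (\<Union>e'\<in>set es. curve D e')"
    by (rule connected_inside_iff)
  then show ?thesis using ab by (simp add: enclosed_def)
qed

lemma not_enclosed_if_end:
  assumes D: "plane_drawing X D" and "e \<in> set es" "set es \<subseteq> edges X" "v \<in> ends X e"
  shows "v \<notin> enclosed X D es"
proof -
  have "point D v \<in> curve D e"
    using point_in_curve[OF D _ assms(4)] assms(2,3) by blast
  then show ?thesis
    using assms(2) inside_no_overlap unfolding enclosed_def by fastforce
qed

section \<open>Perfect matchings and the Leibniz expansion\<close>

lemma set_interleaved:
  "set (map (\<lambda>k. if even k then a (cs ! (k div 2)) else b (cs ! (k div 2))) [0..<2 * length cs]) =
    a ` set cs \<union> b ` set cs" (is "set (map ?h _) = _")
proof -
  have "{0..<2 * length cs} = (\<lambda>m. 2 * m) ` {..<length cs} \<union> (\<lambda>m. 2 * m + 1) ` {..<length cs}"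
  proof (intro equalityI subsetI)
    fix k assume "k \<in> {0..<2 * length cs}"
    then have "k div 2 < length cs" "k = 2 * (k div 2) \<or> k = 2 * (k div 2) + 1" by auto
    then show "k \<in> (\<lambda>m. 2 * m) ` {..<length cs} \<union> (\<lambda>m. 2 * m + 1) ` {..<length cs}" by blast
  qed auto
  moreover have "set cs = (!) cs ` {..<length cs}" by (auto simp: set_conv_nth)
  ultimately show ?thesis by (simp add: image_Un image_image del: if_image_distrib)
qed

definition biadjacency :: "('v, 'e) bigraph \<Rightarrow> ('e \<Rightarrow> 'r::comm_ring_1) \<Rightarrow> 'v \<Rightarrow> 'v \<Rightarrow> 'r" where
  "biadjacency X w b u = (\<Sum>e | e \<in> edges X \<and> ends X e = {b, u}. w e)"

text \<open>
  Determinants are taken of matrices with natural indices, so the two colour classes, assumed to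
  have the same size, are enumerated.
\<close>

locale indexed_bigraph =
  fixes X :: "('v, 'e) bigraph" and bs ws :: "nat \<Rightarrow> 'v" and N :: nat
  assumes fin: "finite_bigraph X"
    and bs: "bij_betw bs {0..<N} (blacks X)"
    and ws: "bij_betw ws {0..<N} (whites X)"
begin

text \<open>
  A perfect matching is encoded by the edge \<open>f i\<close> at each black vertex \<open>bs i\<close>, together with
  the index \<open>p i\<close> of the white end of that edge. The permutation \<open>p\<close> names the Leibniz term to
  which the matching belongs; for parallel edges, several \<open>f\<close> share one \<open>p\<close>. Functions \<open>f\<close> are
  extensional so that the matching determines its code.
\<close>

definition matching_code :: "(nat \<Rightarrow> nat) \<Rightarrow> (nat \<Rightarrow> 'e) \<Rightarrow> bool" where
  "matching_code p f \<longleftrightarrow> p permutes {0..<N} \<and>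
     f \<in> (\<Pi>\<^sub>E i\<in>{0..<N}. {e \<in> edges X. ends X e = {bs i, ws (p i)}})"

lemma bs_black: "i < N \<Longrightarrow> bs i \<in> blacks X"
  using bs by (auto simp: bij_betw_def)

lemma ws_white: "i < N \<Longrightarrow> ws i \<in> whites X"
  using ws by (auto simp: bij_betw_def)

lemma bs_eq_iff: "i < N \<Longrightarrow> j < N \<Longrightarrow> bs i = bs j \<longleftrightarrow> i = j"
  using bs by (auto simp: bij_betw_def inj_on_def)

lemma ws_eq_iff: "i < N \<Longrightarrow> j < N \<Longrightarrow> ws i = ws j \<longleftrightarrow> i = j"
  using ws by (auto simp: bij_betw_def inj_on_def)

lemma bs_neq_ws: "i < N \<Longrightarrow> j < N \<Longrightarrow> bs i \<noteq> ws j"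
  using bs_black ws_white fin by (metis disjoint_iff finite_bigraph_def)

lemma ends_eq_iff:
  assumes "i < N" "j < N" "k < N" "l < N"
  shows "{bs i, ws j} = {bs k, ws l} \<longleftrightarrow> i = k \<and> j = l"
  using assms bs_neq_ws bs_eq_iff ws_eq_iff by (metis doubleton_eq_iff)

lemma blacks_eq: "blacks X = bs ` {0..<N}" and whites_eq: "whites X = ws ` {0..<N}"
  using bs ws by (auto simp: bij_betw_def)

lemma matching_codeD:
  assumes "matching_code p f" "i < N"
  shows "p i < N" "f i \<in> edges X" "ends X (f i) = {bs i, ws (p i)}"
proof -
  show "p i < N" using assms permutes_in_image unfolding matching_code_def by fastforce
  show "f i \<in> edges X" "ends X (f i) = {bs i, ws (p i)}"
    using assms unfolding matching_code_def by (auto dest!: PiE_mem[where x = i])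
qed

lemma matching_code_perm_eq_iff:
  assumes "matching_code p f"
  shows "p i = p j \<longleftrightarrow> i = j"
  using assms permutes_inj unfolding matching_code_def by (metis injD)

lemma matching_code_inj:
  assumes "matching_code p f" "i < N" "j < N" "f i = f j"
  shows "i = j"
  using assms matching_codeD ends_eq_iff by metis

lemma perfect_matching_of_code:
  assumes c: "matching_code p f"
  shows "perfect_matching X (f ` {0..<N})"
  unfolding perfect_matching_def
proof (intro conjI ballI)
  show "f ` {0..<N} \<subseteq> edges X" using matching_codeD[OF c] by auto
  fix v assume "v \<in> verts X"
  then consider i where "i < N" "v = bs i" | j where "j < N" "v = ws j"
    by (auto simp: verts_def blacks_eq whites_eq)
  then show "\<exists>!e. e \<in> f ` {0..<N} \<and> v \<in> ends X e"
  proof cases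
    case 1
    then show ?thesis
      by (intro ex1I[of _ "f i"])
        (auto simp: matching_codeD[OF c] bs_eq_iff bs_neq_ws)
  next
    case 2
    have p: "p permutes {0..<N}" using c by (simp add: matching_code_def)
    then have "j \<in> p ` {0..<N}" using 2(1) permutes_image[OF p] by simp
    then obtain i where i: "i < N" "j = p i" by auto
    with 2 show ?thesis
      by (intro ex1I[of _ "f i"])
        (auto simp: matching_codeD[OF c] ws_eq_iff bs_neq_ws[symmetric] matching_code_perm_eq_iff[OF c])
  qed
qed

lemma code_of_perfect_matching:
  assumes M: "perfect_matching X M"
  obtains p f where "matching_code p f" "M = f ` {0..<N}"
proof -
  have edge: "\<exists>i j. i < N \<and> j < N \<and> ends X e = {bs i, ws j}" if "e \<in> M" for e
  proof -
    have "\<exists>b\<in>blacks X. \<exists>u\<in>whites X. ends X e = {b, u}"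
      using that M fin unfolding perfect_matching_def finite_bigraph_def by blast
    then obtain b u where bu: "b \<in> bs ` {0..<N}" "u \<in> ws ` {0..<N}" "ends X e = {b, u}"
      unfolding blacks_eq whites_eq by blast
    then obtain i j where "i < N" "b = bs i" "j < N" "u = ws j" by auto
    with bu(3) show ?thesis by blast
  qed
  have unique: "e = e'" if "e \<in> M" "e' \<in> M" "v \<in> ends X e" "v \<in> ends X e'" "v \<in> verts X" for e e' v
    using M that unfolding perfect_matching_def by blast
  have "\<exists>e j. e \<in> M \<and> j < N \<and> ends X e = {bs i, ws j}" if i: "i < N" for i
  proof -
    have "bs i \<in> verts X" using bs_black[OF i] by (simp add: verts_def)
    then obtain e where e: "e \<in> M" "bs i \<in> ends X e"
      using M unfolding perfect_matching_def by blast
    obtain i' j where ij: "i' < N" "j < N" "ends X e = {bs i', ws j}" using edge[OF e(1)] by blast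
    then have "i' = i" using e(2) i bs_eq_iff bs_neq_ws by auto
    with e ij show ?thesis by blast
  qed
  then obtain f j where fj: "\<And>i. i < N \<Longrightarrow> f i \<in> M \<and> j i < N \<and> ends X (f i) = {bs i, ws (j i)}"
    by metis
  define p where "p i = (if i < N then j i else i)" for i
  define f' where "f' i = (if i < N then f i else undefined)" for i
  have "inj_on p {0..<N}"
  proof (rule inj_onI)
    fix i i' assume *: "i \<in> {0..<N}" "i' \<in> {0..<N}" "p i = p i'"
    then have "ws (j i) \<in> ends X (f i)" "ws (j i) \<in> ends X (f i')" "ws (j i) \<in> verts X"
      using fj[of i] fj[of i'] ws_white by (auto simp: p_def verts_def)
    then have "f i = f i'" using unique[of "f i" "f i'" "ws (j i)"] fj * by simp
    then show "i = i'" using fj[of i] fj[of i'] ends_eq_iff * by auto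
  qed
  moreover have "p ` {0..<N} \<subseteq> {0..<N}" using fj by (auto simp: p_def)
  ultimately have "bij_betw p {0..<N} {0..<N}"
    by (simp add: bij_betw_def endo_inj_surj)
  then have "p permutes {0..<N}" by (rule bij_imp_permutes) (simp add: p_def)
  then have "matching_code p f'"
    using fj M by (auto simp: matching_code_def perfect_matching_def p_def f'_def)
  moreover have "M = f' ` {0..<N}"
  proof (intro equalityI subsetI)
    fix e assume e: "e \<in> M"
    obtain i k where "i < N" "k < N" "ends X e = {bs i, ws k}" using edge[OF e] by blast
    then have "e = f i" using unique[of e "f i" "bs i"] fj e bs_black by (simp add: verts_def)
    with \<open>i < N\<close> show "e \<in> f' ` {0..<N}" by (auto simp: f'_def)
  qed (use fj in \<open>auto simp: f'_def\<close>)
  ultimately show thesis using that by blast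
qed

lemma bij_betw_matching_codes:
  "bij_betw (\<lambda>(p, f). f ` {0..<N}) {(p, f). matching_code p f} {M. perfect_matching X M}"
  unfolding bij_betw_def
proof (intro conjI inj_onI equalityI subsetI; clarify)
  fix p f q g assume c: "matching_code p f" "matching_code q g" "f ` {0..<N} = g ` {0..<N}"
  have fg: "f i = g i" if "i < N" for i
  proof -
    have "f i \<in> f ` {0..<N}" using that by simp
    then have "f i \<in> g ` {0..<N}" unfolding c(3) .
    then obtain j where j: "j < N" "f i = g j" by auto
    then have "i = j"
      using matching_codeD[OF c(1) that] matching_codeD[OF c(2) j(1)] ends_eq_iff that by metis
    with j show ?thesis by simp
  qed
  have "p i = q i" for i
  proof (cases "i < N")
    case True
    then show ?thesis
      using matching_codeD[OF c(1) True] matching_codeD[OF c(2) True] fg ends_eq_iff by metis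
  next
    case False
    then show ?thesis using c by (auto simp: matching_code_def permutes_def)
  qed
  moreover have "f i = g i" for i
    using fg c(1,2) by (cases "i < N") (auto simp: matching_code_def PiE_def extensional_def)
  ultimately show "p = q \<and> f = g" by (simp add: fun_eq_iff)
next
  fix M assume "perfect_matching X M"
  then show "M \<in> (\<lambda>(p, f). f ` {0..<N}) ` {(p, f). matching_code p f}"
    by (elim code_of_perfect_matching) auto
qed (use perfect_matching_of_code in auto)

lemma matching_sum_eq_sum_codes:
  "matching_sum X w = (\<Sum>(p, f) | matching_code p f. \<Prod>i<N. w (f i))"
proof -
  have "matching_sum X w =
      (\<Sum>(p, f) | matching_code p f. \<Prod>e\<in>f ` {0..<N}. w e)"
    unfolding matching_sum_def
    by (subst sum.reindex_bij_betw[OF bij_betw_matching_codes, symmetric]) (simp add: case_prod_beta)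
  also have "\<dots> = (\<Sum>(p, f) | matching_code p f. \<Prod>i<N. w (f i))"
  proof (intro sum.cong refl, clarify)
    fix p f assume "matching_code p f"
    then have "inj_on f {0..<N}" using matching_code_inj by (auto intro: inj_onI)
    then show "(\<Prod>e\<in>f ` {0..<N}. w e) = (\<Prod>i<N. w (f i))"
      by (simp add: prod.reindex lessThan_atLeast0)
  qed
  finally show ?thesis .
qed

text \<open>
  Each Leibniz term is a product of sums over parallel edges. Multiplying it out chooses one edge
  for every black vertex.
\<close>

lemma det_eq_signed_sum_codes:
  "Determinant.det (mat N N (\<lambda>(i, j). biadjacency X w (bs i) (ws j))) =
    (\<Sum>(p, f) | matching_code p f. of_int (sign p) * (\<Prod>i<N. w (f i)))"
proof -
  let ?E = "\<lambda>i j. {e \<in> edges X. ends X e = {bs i, ws j}}"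
  have finE: "finite (?E i j)" for i j using fin by (simp add: finite_bigraph_def)
  have "Determinant.det (mat N N (\<lambda>(i, j). biadjacency X w (bs i) (ws j))) =
      (\<Sum>p | p permutes {0..<N}. of_int (sign p) * (\<Prod>i\<in>{0..<N}. \<Sum>e\<in>?E i (p i). w e))"
  proof (subst det_def', rule mat_carrier, intro sum.cong refl)
    fix p assume "p \<in> {p. p permutes {0..<N}}"
    then have "p i < N" if "i < N" for i using that permutes_in_image by fastforce
    then show "of_int (sign p) * (\<Prod>i = 0..<N. mat N N (\<lambda>(i, j). biadjacency X w (bs i) (ws j)) $$ (i, p i)) =
        of_int (sign p) * (\<Prod>i\<in>{0..<N}. \<Sum>e\<in>?E i (p i). w e)"
      by (auto simp: biadjacency_def intro!: prod.cong)
  qed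
  also have "\<dots> = (\<Sum>p | p permutes {0..<N}. \<Sum>f\<in>(\<Pi>\<^sub>E i\<in>{0..<N}. ?E i (p i)).
      of_int (sign p) * (\<Prod>i<N. w (f i)))"
    using finE by (subst prod_sum_PiE) (auto simp: sum_distrib_left lessThan_atLeast0)
  also have "\<dots> = (\<Sum>(p, f)\<in>(SIGMA p:{p. p permutes {0..<N}}. \<Pi>\<^sub>E i\<in>{0..<N}. ?E i (p i)).
      of_int (sign p) * (\<Prod>i<N. w (f i)))"
    using finE by (intro sum.Sigma) (auto simp: finite_permutations intro!: finite_PiE)
  also have "(SIGMA p:{p. p permutes {0..<N}}. \<Pi>\<^sub>E i\<in>{0..<N}. ?E i (p i)) = {(p, f). matching_code p f}"
    by (auto simp: matching_code_def)
  finally show ?thesis .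
qed

section \<open>Alternating cycles and Kasteleyn's theorem\<close>

text \<open>
  Going from a black vertex along the edge \<open>f\<close> to a white one, and from there back along the edge
  \<open>g\<close> of the second matching, realises \<open>r\<close> as the step from a black vertex to the next one. A
  cycle of \<open>r\<close> is thus an alternating closed walk: either one edge common to both matchings,
  or a simple cycle with twice as many vertices.
\<close>

lemma signed_product_along_cycle:
  fixes \<sigma> :: "'e \<Rightarrow> int"
  assumes D: "plane_drawing X D" and \<sigma>: "sign_function X D \<sigma>"
    and f: "matching_code p f" and g: "matching_code q g"
    and r: "\<And>i. i < N \<Longrightarrow> r i < N \<and> q (r i) = p i"
    and cs: "distinct cs" "cs \<noteq> []" "set cs \<subseteq> {0..<N}"
    and cyc: "\<And>k. k < length cs \<Longrightarrow> r (cs ! k) = cs ! (Suc k mod length cs)"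
  shows "(\<Prod>i\<in>set cs. \<sigma> (f i) * \<sigma> (g i)) = (- 1) ^ (length cs - 1)"
proof (cases "\<exists>i\<in>set cs. \<exists>j\<in>set cs. f i = g j")
  case True
  then obtain i j where ij: "i \<in> set cs" "j \<in> set cs" "f i = g j" by blast
  then have lt: "i < N" "j < N" using cs(3) by auto
  have eq: "i = j" "p i = q j"
    using matching_codeD[OF f lt(1)] matching_codeD[OF g lt(2)] ends_eq_iff lt ij(3) by metis+
  \<comment> \<open>A common edge makes the walk return at once, so the cycle is a fixed point of \<open>r\<close>.\<close>
  then have "r i = i"
    using r[OF lt(1)] matching_code_perm_eq_iff[OF g] by metis
  obtain k where k: "k < length cs" "cs ! k = i" using ij(1) by (auto simp: in_set_conv_nth)
  then have "cs ! (Suc k mod length cs) = cs ! k"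
    using cyc[OF k(1)] k(2) \<open>r i = i\<close> by simp
  then have "Suc k mod length cs = k" using cs(1,2) k(1) by (simp add: nth_eq_iff_index_eq)
  then have "length cs = 1" using k(1) by (auto simp: mod_Suc split: if_splits)
  then have "set cs = {i}" using ij(1) by (cases cs) auto
  then have "(\<Prod>i\<in>set cs. \<sigma> (f i) * \<sigma> (g i)) = \<sigma> (f i) * \<sigma> (g i)" by simp
  also have "\<dots> = 1"
    using sign_function_square[OF \<sigma> matching_codeD(2)[OF f lt(1)]] ij(3) eq(1) by simp
  finally show ?thesis using \<open>length cs = 1\<close> by simp
next
  case False
  let ?l = "length cs"
  \<comment> \<open>Even positions hold the black vertices and edges of the first matching, odd positions the
    white vertices and edges of the second one.\<close>
  define vs where "vs = map (\<lambda>k. if even k then bs (cs ! (k div 2)) else ws (p (cs ! (k div 2)))) [0..<2 * ?l]"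
  define es where "es = map (\<lambda>k. if even k then f (cs ! (k div 2)) else g (r (cs ! (k div 2)))) [0..<2 * ?l]"
  have N: "i < N" if "i \<in> set cs" for i using that cs(3) by auto
  have pN: "p i < N" if "i \<in> set cs" for i using matching_codeD[OF f N[OF that]] by simp
  have r_cs: "r ` set cs = set cs"
  proof (rule endo_inj_surj)
    show "r ` set cs \<subseteq> set cs"
    proof clarify
      fix i assume "i \<in> set cs"
      then obtain k where "k < ?l" "i = cs ! k" by (auto simp: in_set_conv_nth)
      then show "r i \<in> set cs" using cyc[of k] cs(2) by (simp add: nth_mem)
    qed
    show "inj_on r (set cs)"
      using r N matching_code_perm_eq_iff[OF f] by (metis inj_onI)
  qed simp
  have set_es: "set es = f ` set cs \<union> g ` set cs"
    unfolding es_def set_interleaved[of f cs "\<lambda>i. g (r i)"] using r_cs by (metis image_image)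
  have set_vs: "set vs = bs ` set cs \<union> (\<lambda>i. ws (p i)) ` set cs"
    unfolding vs_def by (rule set_interleaved)
  have inj: "inj_on f (set cs)" "inj_on g (set cs)"
    using matching_code_inj[OF f] matching_code_inj[OF g] N by (auto intro!: inj_onI)
  have disj: "f ` set cs \<inter> g ` set cs = {}" using False by blast
  have "card (set es) = ?l + ?l"
    unfolding set_es using disj inj cs(1) by (simp add: card_Un_disjoint card_image distinct_card)
  then have dist_es: "distinct es" by (intro card_distinct) (simp add: es_def)
  have "card (set vs) = ?l + ?l"
  proof -
    have "inj_on bs (set cs)" "inj_on (\<lambda>i. ws (p i)) (set cs)"
      using N pN bs_eq_iff ws_eq_iff matching_code_perm_eq_iff[OF f] by (auto intro!: inj_onI)
    moreover have "bs ` set cs \<inter> (\<lambda>i. ws (p i)) ` set cs = {}"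
      using N pN bs_neq_ws by fastforce
    ultimately show ?thesis
      unfolding set_vs using cs(1) by (simp add: card_Un_disjoint card_image distinct_card)
  qed
  then have dist_vs: "distinct vs" by (intro card_distinct) (simp add: vs_def)
  have es_edges: "set es \<subseteq> edges X"
    using matching_codeD(2)[OF f] matching_codeD(2)[OF g] N by (auto simp: set_es)
  have "simple_cycle X vs es"
    unfolding simple_cycle_def
  proof (intro conjI allI impI)
    show "length es = length vs" by (simp add: es_def vs_def)
    show "2 \<le> length es" using cs(2) by (cases cs) (simp_all add: es_def)
    show "set vs \<subseteq> verts X"
      using N pN bs_black ws_white by (auto simp: set_vs verts_def)
    fix k assume k: "k < length es"
    then have k': "k div 2 < ?l" "k < 2 * ?l" by (auto simp: es_def)
    let ?i = "cs ! (k div 2)"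
    have i: "?i \<in> set cs" using k' by simp
    show "ends X (es ! k) = {vs ! k, vs ! (Suc k mod length vs)}"
    proof (cases "even k")
      case True
      then have "Suc k < 2 * ?l" using k' by presburger
      with True k' i show ?thesis
        using matching_codeD(3)[OF f N[OF i]] by (simp add: es_def vs_def)
    next
      case False
      have "Suc k mod (2 * ?l) = 2 * (Suc (k div 2) mod ?l)"
      proof -
        have "Suc k = 2 * Suc (k div 2)" using False by presburger
        then show ?thesis by (simp only: mult_mod_right)
      qed
      moreover have "Suc (k div 2) mod ?l < ?l" using cs(2) by simp
      ultimately have "vs ! (Suc k mod length vs) = bs (cs ! (Suc (k div 2) mod ?l))"
        by (simp add: vs_def)
      then have "vs ! (Suc k mod length vs) = bs (r ?i)" using cyc[OF k'(1)] by simp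
      with False k' i show ?thesis
        using matching_codeD(3)[OF g, of "r ?i"] r[OF N[OF i]]
        by (auto simp: es_def vs_def)
    qed
  qed (fact dist_es dist_vs es_edges)+
  moreover have "length es = 2 * ?l" by (simp add: es_def)
  moreover have "even (card (enclosed X D es))"
  proof -
    define I where "I = {i \<in> {0..<N}. bs i \<in> enclosed X D es}"
    define J where "J = {j \<in> {0..<N}. ws j \<in> enclosed X D es}"
    \<comment> \<open>The first matching pairs off the enclosed vertices: its edges at vertices of the cycle
      belong to the cycle, and all its other edges are disjoint from the cycle.\<close>
    have iff: "bs i \<in> enclosed X D es \<longleftrightarrow> ws (p i) \<in> enclosed X D es" if i: "i < N" for i
    proof (cases "i \<in> set cs")
      case True
      then have "f i \<in> set es" by (simp add: set_es)
      then show ?thesis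
        using not_enclosed_if_end[OF D _ es_edges] matching_codeD(3)[OF f i] by blast
    next
      case False
      show ?thesis
      proof (rule enclosed_iff_across_edge[OF D matching_codeD(2,3)[OF f i] _ _ es_edges])
        show "bs i \<in> verts X" "ws (p i) \<in> verts X"
          using i matching_codeD(1)[OF f i] bs_black ws_white by (auto simp: verts_def)
        fix e assume "e \<in> set es"
        then have "e \<in> f ` set cs \<union> g ` r ` set cs" by (simp add: set_es r_cs)
        then obtain j where j: "j \<in> set cs" "e = f j \<or> e = g (r j)" by auto
        obtain k where k: "k \<in> set cs" "ends X e = {bs k, ws (p j)}"
        proof (cases "e = f j")
          case True
          then show thesis using that[OF j(1)] matching_codeD(3)[OF f N[OF j(1)]] by simp
        next
          case False
          have "r j \<in> set cs" using j(1) r_cs by blast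
          then show thesis
            using that False j(2) matching_codeD(3)[OF g, of "r j"] r[OF N[OF j(1)]] by simp
        qed
        have "bs i \<noteq> bs k" using bs_eq_iff[OF i N[OF k(1)]] k(1) False by auto
        moreover have "ws (p i) \<noteq> ws (p j)"
          using ws_eq_iff[OF matching_codeD(1)[OF f i] pN[OF j(1)]] matching_code_perm_eq_iff[OF f]
            j(1) False by auto
        moreover have "bs i \<noteq> ws (p j)" "bs k \<noteq> ws (p i)"
          using bs_neq_ws i pN[OF j(1)] N[OF k(1)] matching_codeD(1)[OF f i] by simp_all
        ultimately show "ends X (f i) \<inter> ends X e = {}"
          unfolding matching_codeD(3)[OF f i] k(2) by auto
      qed
    qed
    have p: "p permutes {0..<N}" using f by (simp add: matching_code_def)
    have "J = p ` I"
    proof (intro equalityI subsetI)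
      fix j assume j: "j \<in> J"
      then have "j \<in> p ` {0..<N}" using permutes_image[OF p] by (simp add: J_def)
      then obtain i where "i < N" "j = p i" by auto
      with j iff show "j \<in> p ` I" by (auto simp: I_def J_def)
    qed (use iff matching_codeD(1)[OF f] in \<open>auto simp: I_def J_def\<close>)
    then have "card J = card I"
      using permutes_inj[OF p] by (simp add: card_image inj_on_def)
    moreover have "card (bs ` I) = card I" "card (ws ` J) = card J"
      using bs_eq_iff ws_eq_iff by (auto simp: I_def J_def intro!: card_image inj_onI)
    moreover have "enclosed X D es = bs ` I \<union> ws ` J"
      by (auto simp: I_def J_def enclosed_def verts_def blacks_eq whites_eq)
    moreover have "card (bs ` I \<union> ws ` J) = card (bs ` I) + card (ws ` J)"
      using bs_neq_ws by (intro card_Un_disjoint) (auto simp: I_def J_def)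
    ultimately show ?thesis by simp
  qed
  ultimately have "(\<Prod>e\<in>set es. \<sigma> e) = (- 1) ^ (?l - 1)"
    by (rule sign_function_cycle[OF \<sigma>])
  moreover have "(\<Prod>e\<in>set es. \<sigma> e) = (\<Prod>i\<in>set cs. \<sigma> (f i) * \<sigma> (g i))"
    unfolding set_es using disj inj by (simp add: prod.union_disjoint prod.reindex prod.distrib)
  ultimately show ?thesis by simp
qed

text \<open>
  The permutations of two matchings differ by the permutation whose cycles are the alternating
  cycles, so its sign is the product of all signs of both matchings.
\<close>

lemma sign_times_signs_unique:
  fixes \<sigma> :: "'e \<Rightarrow> int"
  assumes D: "plane_drawing X D" and \<sigma>: "sign_function X D \<sigma>"
    and f: "matching_code p f" and g: "matching_code q g"
  shows "sign p * (\<Prod>i<N. \<sigma> (f i)) = sign q * (\<Prod>i<N. \<sigma> (g i))"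
proof -
  have p: "p permutes {0..<N}" and q: "q permutes {0..<N}"
    using f g by (simp_all add: matching_code_def)
  let ?r = "Hilbert_Choice.inv q \<circ> p"
  have r: "?r permutes {0..<N}" using p q by (intro permutes_compose permutes_inv)
  have rN: "?r i < N \<and> q (?r i) = p i" if "i < N" for i
    using that permutes_in_image[OF r, of i] permutes_inverses(1)[OF q] by simp
  have perm: "permutation p" "permutation q" "permutation (Hilbert_Choice.inv q)"
    using p q permutes_inv[OF q] permutation_permutes by blast+
  have "sign q * sign p = sign ?r"
    using perm by (simp add: sign_compose sign_inverse)
  also have "\<dots> = (\<Prod>i\<in>{0..<N}. \<sigma> (f i) * \<sigma> (g i))"
    using signed_product_along_cycle[OF D \<sigma> f g rN]
    by (intro sign_eq_prod_over_cycles[OF r]) auto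
  also have "\<dots> = (\<Prod>i<N. \<sigma> (f i)) * (\<Prod>i<N. \<sigma> (g i))"
    by (simp add: prod.distrib lessThan_atLeast0)
  finally have qp: "sign q * sign p = (\<Prod>i<N. \<sigma> (f i)) * (\<Prod>i<N. \<sigma> (g i))" .
  have "(\<Prod>i<N. \<sigma> (f i)) * (\<Prod>i<N. \<sigma> (f i)) = (\<Prod>i<N. 1)"
    unfolding prod.distrib[symmetric]
    using sign_function_square[OF \<sigma>] matching_codeD(2)[OF f] by (intro prod.cong) simp_all
  then have ff: "(\<Prod>i<N. \<sigma> (f i)) * (\<Prod>i<N. \<sigma> (f i)) = 1" by simp
  have "sign p * (\<Prod>i<N. \<sigma> (f i)) = sign q * (sign q * sign p) * (\<Prod>i<N. \<sigma> (f i))"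
    by (simp add: ac_simps)
  also have "\<dots> = sign q * (\<Prod>i<N. \<sigma> (g i)) * ((\<Prod>i<N. \<sigma> (f i)) * (\<Prod>i<N. \<sigma> (f i)))"
    unfolding qp by (simp only: ac_simps)
  finally show ?thesis by (simp add: ff)
qed

text \<open>
  Kasteleyn's theorem. The unit \<open>c\<close> is \<open>1\<close> or \<open>-1\<close> and is described by \<open>c * c = 1\<close>, which is
  the property that cancels it in divisibility statements.
\<close>

theorem det_eq_matching_sum:
  fixes w :: "'e \<Rightarrow> 'r::idom" and \<sigma> :: "'e \<Rightarrow> int"
  assumes D: "plane_drawing X D" and \<sigma>: "sign_function X D \<sigma>"
  shows "\<exists>c::'r. c * c = 1 \<and>
    Determinant.det (mat N N (\<lambda>(i, j). biadjacency X (\<lambda>e. of_int (\<sigma> e) * w e) (bs i) (ws j))) =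
      c * matching_sum X w"
proof -
  let ?s = "\<lambda>p f. sign p * (\<Prod>i<N. \<sigma> (f i))"
  \<comment> \<open>Without perfect matchings both sides vanish and every unit will do.\<close>
  have "\<exists>c::int. c * c = 1 \<and> (\<forall>p f. matching_code p f \<longrightarrow> ?s p f = c)"
  proof (cases "\<exists>p f. matching_code p f")
    case True
    then obtain q g where g: "matching_code q g" by blast
    have "(\<Prod>i<N. \<sigma> (g i)) * (\<Prod>i<N. \<sigma> (g i)) = (\<Prod>i<N. 1)"
      unfolding prod.distrib[symmetric]
      using sign_function_square[OF \<sigma>] matching_codeD(2)[OF g] by (intro prod.cong) simp_all
    then have gg: "(\<Prod>i<N. \<sigma> (g i)) * (\<Prod>i<N. \<sigma> (g i)) = 1" by simp
    have "?s q g * ?s q g = (sign q * sign q) * ((\<Prod>i<N. \<sigma> (g i)) * (\<Prod>i<N. \<sigma> (g i)))"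
      by (simp only: ac_simps)
    then have "?s q g * ?s q g = 1" by (simp add: gg)
    then show ?thesis using sign_times_signs_unique[OF D \<sigma> _ g] by blast
  next
    case False
    then show ?thesis by (intro exI[of _ 1]) auto
  qed
  then obtain c :: int where c: "c * c = 1" "\<And>p f. matching_code p f \<Longrightarrow> ?s p f = c" by blast
  have "Determinant.det (mat N N (\<lambda>(i, j). biadjacency X (\<lambda>e. of_int (\<sigma> e) * w e) (bs i) (ws j))) =
      (\<Sum>(p, f) | matching_code p f. of_int (sign p) * (\<Prod>i<N. of_int (\<sigma> (f i)) * w (f i)))"
    by (rule det_eq_signed_sum_codes)
  also have "\<dots> = (\<Sum>(p, f) | matching_code p f. of_int c * (\<Prod>i<N. w (f i)))"
  proof (intro sum.cong refl, clarify)
    fix p f assume "matching_code p f"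
    then have "of_int (?s p f) = (of_int c :: 'r)" using c(2) by simp
    then show "of_int (sign p) * (\<Prod>i<N. of_int (\<sigma> (f i)) * w (f i)) = of_int c * (\<Prod>i<N. w (f i))"
      by (simp add: prod.distrib flip: mult.assoc)
  qed
  also have "\<dots> = of_int c * matching_sum X w"
    unfolding matching_sum_eq_sum_codes by (simp add: sum_distrib_left case_prod_beta)
  finally have "Determinant.det (mat N N (\<lambda>(i, j). biadjacency X (\<lambda>e. of_int (\<sigma> e) * w e) (bs i) (ws j))) =
      of_int c * matching_sum X w" .
  moreover have "of_int c * of_int c = (1::'r)"
    using c(1) by (simp flip: of_int_mult)
  ultimately show ?thesis by blast
qed

end

section \<open>A copy of the base graph inside the compound graph\<close>

lemma base_vert_iff:
  "BaseV s v \<in> verts (compound_graph C) \<longleftrightarrow> s \<in> verts (supergraph C) \<and> v \<in> verts (base C)"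
  by (auto simp: compound_graph_def verts_def)

lemma base_edge_iff:
  "BaseE s e \<in> edges (compound_graph C) \<longleftrightarrow> s \<in> verts (supergraph C) \<and> e \<in> edges (base C)"
  by (auto simp: compound_graph_def)

lemma ends_compound_graph [simp]: "ends (compound_graph C) = cends C"
  by (simp add: compound_graph_def)

lemma finite_bigraph_ends_subset:
  assumes "finite_bigraph X" "e \<in> edges X"
  shows "ends X e \<subseteq> verts X"
proof -
  obtain b u where "b \<in> blacks X" "u \<in> whites X" "ends X e = {b, u}"
    using assms unfolding finite_bigraph_def by blast
  then show ?thesis by (simp add: verts_def)
qed

definition copy_drawing :: "(('v, 's, 't, 'l) cvert, ('e, 's, 't, 'l) cedge) drawing \<Rightarrow> 's \<Rightarrow>
    ('v, 'e) drawing" where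
  "copy_drawing D s = \<lparr>point = \<lambda>v. point D (BaseV s v), curve = \<lambda>e. curve D (BaseE s e)\<rparr>"

lemma plane_drawing_copy:
  assumes D: "plane_drawing (compound_graph C) D"
    and s: "s \<in> verts (supergraph C)" and fin: "finite_bigraph (base C)"
  shows "plane_drawing (base C) (copy_drawing D s)"
proof -
  let ?H = "compound_graph C" and ?D = "copy_drawing D s"
  have img: "point ?D ` A = point D ` BaseV s ` A" for A
    by (simp add: copy_drawing_def image_image)
  have crv: "curve ?D e = curve D (BaseE s e)" for e by (simp add: copy_drawing_def)
  have edge: "BaseE s e \<in> edges ?H" if "e \<in> edges (base C)" for e
    using that s by (simp add: base_edge_iff)
  have vert: "BaseV s ` verts (base C) \<subseteq> verts ?H" using s by (auto simp: base_vert_iff)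
  have "inj_on (point D) (verts ?H)" using D by (simp add: plane_drawing_def)
  then have "inj_on (point D) (BaseV s ` verts (base C))" using vert by (rule inj_on_subset)
  then have "inj_on (point ?D) (verts (base C))"
    by (auto simp: inj_on_def copy_drawing_def)
  moreover have "\<exists>g. arc g \<and> path_image g = curve ?D e \<and> {pathstart g, pathfinish g} = point ?D ` ends (base C) e"
    if "e \<in> edges (base C)" for e
    using plane_drawing_arc[OF D edge[OF that]] by (simp add: crv img)
  moreover have "curve ?D e \<inter> point ?D ` verts (base C) = point ?D ` ends (base C) e"
    if e: "e \<in> edges (base C)" for e
  proof -
    have *: "curve D (BaseE s e) \<inter> point D ` verts ?H = point D ` BaseV s ` ends (base C) e"
      using curve_Int_points[OF D edge[OF e]] by simp
    have "point D ` BaseV s ` verts (base C) \<subseteq> point D ` verts ?H" using vert by (rule image_mono)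
    moreover have "point D ` BaseV s ` ends (base C) e \<subseteq> point D ` BaseV s ` verts (base C)"
      using finite_bigraph_ends_subset[OF fin e] by (intro image_mono)
    ultimately show ?thesis unfolding crv img using * by blast
  qed
  moreover have "curve ?D e \<inter> curve ?D e' = point ?D ` (ends (base C) e \<inter> ends (base C) e')"
    if "e \<in> edges (base C)" "e' \<in> edges (base C)" "e \<noteq> e'" for e e'
    using curve_Int_curve[OF D edge[OF that(1)] edge[OF that(2)]] that(3)
    by (simp add: crv img image_Int inj_on_def)
  ultimately show ?thesis by (simp add: plane_drawing_def)
qed

text \<open>
  A vertex of the compound graph outside the copy lies in the unbounded component of the complement
  of the copy, hence also in that of the smaller set covered by the cycle.
\<close>

lemma enclosed_copy:
  assumes CD: "compound_drawing C D" and s: "s \<in> verts (supergraph C)"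
    and es: "set es \<subseteq> edges (base C)"
    and fin: "finite_bigraph (base C)"
  shows "enclosed (compound_graph C) D (map (BaseE s) es) =
    BaseV s ` enclosed (base C) (copy_drawing D s) es" (is "?L = ?R")
proof (intro equalityI subsetI)
  let ?H = "compound_graph C" and ?\<Gamma> = "\<Union>e\<in>set es. curve D (BaseE s e)"
  have D: "plane_drawing ?H D" using CD by (simp add: compound_drawing_def)
  have inj: "inj_on (point D) (verts ?H)" using D by (simp add: plane_drawing_def)
  fix x assume "x \<in> enclosed ?H D (map (BaseE s) es)"
  then have x: "x \<in> verts ?H" "point D x \<in> inside ?\<Gamma>" by (simp_all add: enclosed_def)
  have "x \<in> BaseV s ` verts (base C)"
  proof (rule ccontr)
    assume nin: "x \<notin> BaseV s ` verts (base C)"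
    have neq: "point D x \<noteq> point D (BaseV s v)" if v: "v \<in> verts (base C)" for v
    proof
      assume "point D x = point D (BaseV s v)"
      then have "x = BaseV s v"
        using inj x(1) v s by (simp add: inj_on_eq_iff base_vert_iff)
      then show False using nin v by blast
    qed
    have "point D x \<notin> curve D (BaseE s e)" if e: "e \<in> edges (base C)" for e
    proof
      assume "point D x \<in> curve D (BaseE s e)"
      then have "point D x \<in> curve D (BaseE s e) \<inter> point D ` verts ?H" using x(1) by blast
      also have "\<dots> = point D ` BaseV s ` ends (base C) e"
        using curve_Int_points[OF D, of "BaseE s e"] e s by (simp add: base_edge_iff)
      finally show False using neq finite_bigraph_ends_subset[OF fin e] by blast
    qed
    then have "point D x \<notin> copy_drawn C D s" using neq by (auto simp: copy_drawn_def)
    moreover have "point D x \<in> drawn ?H D" using x(1) by (simp add: drawn_def)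
    moreover have "drawn ?H D - copy_drawn C D s \<subseteq> outside (copy_drawn C D s)"
      using CD s by (simp add: compound_drawing_def)
    ultimately have "point D x \<in> outside (copy_drawn C D s)" by blast
    moreover have "?\<Gamma> \<subseteq> copy_drawn C D s" using es by (auto simp: copy_drawn_def)
    then have "outside (copy_drawn C D s) \<subseteq> outside ?\<Gamma>" by (rule outside_mono)
    ultimately have "point D x \<in> inside ?\<Gamma> \<inter> outside ?\<Gamma>" using x(2) by blast
    then show False by simp
  qed
  then show "x \<in> BaseV s ` enclosed (base C) (copy_drawing D s) es"
    using x(2) by (auto simp: enclosed_def copy_drawing_def)
next
  fix x assume "x \<in> ?R"
  then show "x \<in> ?L"
    using s by (auto simp: enclosed_def copy_drawing_def base_vert_iff)
qed

text \<open>
  A cycle of the base graph, drawn as its copy at \<open>s\<close>, is a cycle of the compound graph that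
  encloses equally many vertices, so the condition on its signs is inherited.
\<close>

lemma sign_function_copy:
  assumes CD: "compound_drawing C D" and \<sigma>: "sign_function (compound_graph C) D \<sigma>"
    and s: "s \<in> verts (supergraph C)" and fin: "finite_bigraph (base C)"
  shows "sign_function (base C) (copy_drawing D s) (\<lambda>e. \<sigma> (BaseE s e))"
  unfolding sign_function_def
proof (intro conjI allI impI ballI; (elim conjE)?)
  fix e assume "e \<in> edges (base C)"
  then show "\<sigma> (BaseE s e) \<in> {1, - 1}"
    using \<sigma> s by (simp add: sign_function_def base_edge_iff)
next
  fix vs es l
  assume c: "simple_cycle (base C) vs es" and l: "length es = 2 * l"
    and ev: "even (card (enclosed (base C) (copy_drawing D s) es))"
  have es: "set es \<subseteq> edges (base C)" using c by (simp add: simple_cycle_def)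
  have pos: "length vs > 0" using c by (auto simp: simple_cycle_def)
  have "simple_cycle (compound_graph C) (map (BaseV s) vs) (map (BaseE s) es)"
    unfolding simple_cycle_def
  proof (intro conjI allI impI)
    show "set (map (BaseV s) vs) \<subseteq> verts (compound_graph C)"
      using c s by (auto simp: simple_cycle_def base_vert_iff)
    show "set (map (BaseE s) es) \<subseteq> edges (compound_graph C)"
      using es s by (auto simp: base_edge_iff)
    show "length (map (BaseE s) es) = length (map (BaseV s) vs)" "2 \<le> length (map (BaseE s) es)"
      "distinct (map (BaseV s) vs)" "distinct (map (BaseE s) es)"
      using c by (simp_all add: simple_cycle_def distinct_map inj_on_def)
    fix i assume "i < length (map (BaseE s) es)"
    then show "ends (compound_graph C) (map (BaseE s) es ! i) =
        {map (BaseV s) vs ! i, map (BaseV s) vs ! (Suc i mod length (map (BaseV s) vs))}"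
      using c pos by (simp add: simple_cycle_def)
  qed
  moreover have "length (map (BaseE s) es) = 2 * l" using l by simp
  moreover have "even (card (enclosed (compound_graph C) D (map (BaseE s) es)))"
    using ev by (simp add: enclosed_copy[OF CD s es fin] card_image inj_on_def)
  ultimately have "(\<Prod>e\<in>set (map (BaseE s) es). \<sigma> e) = (- 1) ^ (l - 1)"
    by (rule sign_function_cycle[OF \<sigma>])
  then show "(\<Prod>e\<in>set es. \<sigma> (BaseE s e)) = (- 1) ^ (l - 1)"
    by (simp add: prod.reindex inj_on_def)
qed

section \<open>The signed matrix of the compound graph\<close>

lemma compound_blacks:
  "blacks (compound_graph C) =
    (\<lambda>(s, v). BaseV s v) ` (verts (supergraph C) \<times> blacks (base C)) \<union> Stem ` stems C"
  by (auto simp: compound_graph_def)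

lemma compound_whites:
  "whites (compound_graph C) =
    (\<lambda>(s, v). BaseV s v) ` (verts (supergraph C) \<times> whites (base C)) \<union> Leaf ` leaves C"
  by (auto simp: compound_graph_def)

lemma finite_bigraph_verts: "finite_bigraph X \<Longrightarrow> finite (verts X)"
  by (simp add: finite_bigraph_def verts_def)

lemma finite_bigraph_compound:
  assumes "compound_data C"
  shows "finite_bigraph (compound_graph C)"
proof -
  let ?H = "compound_graph C"
  have G: "finite_bigraph (base C)" and S: "finite_bigraph (supergraph C)"
    using assms by (simp_all add: compound_data_def)
  have fin: "finite (verts (supergraph C))" "finite (blacks (base C))" "finite (whites (base C))"
    "finite (edges (base C))" "finite (stems C)" "finite (leaves C)"
    using assms by (simp_all add: compound_data_def finite_bigraph_def verts_def)
  have "edges ?H \<subseteq> (\<lambda>(s, e). BaseE s e) ` (verts (supergraph C) \<times> edges (base C)) \<union>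
      (\<lambda>(t, s). StemE t s) ` (stems C \<times> verts (supergraph C)) \<union> LeafE ` leaves C"
  proof -
    have "s \<in> verts (supergraph C)" if "t \<in> stems C" "s \<in> ends (supergraph C) (stem_edge C t)" for t s
      using that assms finite_bigraph_ends_subset[OF S] unfolding compound_data_def by blast
    then show ?thesis by (auto simp: compound_graph_def)
  qed
  then have "finite (edges ?H)" by (rule finite_subset) (use fin in auto)
  moreover have "finite (blacks ?H)" "finite (whites ?H)"
    using fin by (auto simp: compound_blacks compound_whites)
  moreover have "blacks ?H \<inter> whites ?H = {}"
    using G by (auto simp: compound_blacks compound_whites finite_bigraph_def)
  moreover have "\<exists>b\<in>blacks ?H. \<exists>u\<in>whites ?H. ends ?H x = {b, u}" if "x \<in> edges ?H" for x
  proof (cases x)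
    case (BaseE s e)
    then have se: "s \<in> verts (supergraph C)" "e \<in> edges (base C)" using that by (simp_all add: base_edge_iff)
    then obtain b u where "b \<in> blacks (base C)" "u \<in> whites (base C)" "ends (base C) e = {b, u}"
      using G unfolding finite_bigraph_def by blast
    then show ?thesis using se(1) BaseE
      by (intro bexI[of _ "BaseV s b"] bexI[of _ "BaseV s u"]) (auto simp: compound_blacks compound_whites)
  next
    case (StemE t s)
    then have ts: "t \<in> stems C" "s \<in> ends (supergraph C) (stem_edge C t)"
      using that by (auto simp: compound_graph_def)
    then have "s \<in> verts (supergraph C)" "stem_foot C t \<in> whites (base C)"
      using assms finite_bigraph_ends_subset[OF S] unfolding compound_data_def by blast+
    then show ?thesis using ts StemE
      by (intro bexI[of _ "Stem t"] bexI[of _ "BaseV s (stem_foot C t)"])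
        (auto simp: compound_blacks compound_whites)
  next
    case (LeafE l)
    then have "l \<in> leaves C" using that by (auto simp: compound_graph_def)
    then show ?thesis using assms LeafE
      by (intro bexI[of _ "BaseV (leaf_copy C l) (leaf_foot C l)"] bexI[of _ "Leaf l"])
        (auto simp: compound_blacks compound_whites compound_data_def insert_commute)
  qed
  ultimately show ?thesis by (simp add: finite_bigraph_def)
qed

lemma card_compound_blacks_whites:
  assumes "compound_data C"
  shows "card (blacks (compound_graph C)) = card (whites (compound_graph C))"
proof -
  have fin: "finite (verts (supergraph C))" "finite (blacks (base C))" "finite (whites (base C))"
    "finite (stems C)" "finite (leaves C)"
    and card: "card (blacks (base C)) = card (whites (base C))" "card (leaves C) = card (stems C)"
    using assms by (simp_all add: compound_data_def finite_bigraph_def verts_def)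
  have "card (blacks (compound_graph C)) =
      card (verts (supergraph C)) * card (blacks (base C)) + card (stems C)"
    unfolding compound_blacks using fin
    by (subst card_Un_disjoint) (auto simp: card_image inj_on_def card_cartesian_product)
  moreover have "card (whites (compound_graph C)) =
      card (verts (supergraph C)) * card (whites (base C)) + card (leaves C)"
    unfolding compound_whites using fin
    by (subst card_Un_disjoint) (auto simp: card_image inj_on_def card_cartesian_product)
  ultimately show ?thesis using card by simp
qed

lemma biadjacency_base_base:
  "biadjacency (compound_graph C) w (BaseV s b) (BaseV s' u) =
    (if s = s' \<and> s \<in> verts (supergraph C) then biadjacency (base C) (\<lambda>e. w (BaseE s e)) b u else 0)"
proof -
  have "{x \<in> edges (compound_graph C). ends (compound_graph C) x = {BaseV s b, BaseV s' u}} =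
      (if s = s' \<and> s \<in> verts (supergraph C)
       then BaseE s ` {e \<in> edges (base C). ends (base C) e = {b, u}} else {})" (is "?L = ?R")
  proof (intro equalityI subsetI)
    fix x assume x: "x \<in> ?L"
    then obtain s'' e where e: "x = BaseE s'' e" "s'' \<in> verts (supergraph C)" "e \<in> edges (base C)"
      by (cases x) (auto simp: compound_graph_def)
    then have eq: "cends C (BaseE s'' e) = {BaseV s b, BaseV s' u}" using x by simp
    then have "BaseV s b \<in> cends C (BaseE s'' e)" "BaseV s' u \<in> cends C (BaseE s'' e)"
      by (simp_all only: insert_iff simp_thms)
    then have s: "s = s''" "s' = s''" by auto
    then have "cends C (BaseE s'' e) = BaseV s'' ` {b, u}" using eq by simp
    then have "ends (base C) e = {b, u}" 
      by (simp only: cends.simps inj_image_eq_iff[of "BaseV s''"] inj_def cvert.inject simp_thms)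
    then show "x \<in> ?R" using e s by auto
  qed (auto simp: base_edge_iff split: if_splits)
  then show ?thesis
    unfolding biadjacency_def by (auto simp: sum.reindex inj_on_def)
qed

lemma biadjacency_stem_base:
  assumes "t \<in> stems C"
  shows "biadjacency (compound_graph C) w (Stem t) (BaseV s u) =
    (if s \<in> ends (supergraph C) (stem_edge C t) \<and> u = stem_foot C t then w (StemE t s) else 0)"
proof -
  have "{x \<in> edges (compound_graph C). ends (compound_graph C) x = {Stem t, BaseV s u}} =
      (if s \<in> ends (supergraph C) (stem_edge C t) \<and> u = stem_foot C t then {StemE t s} else {})"
    (is "?L = ?R")
  proof (intro equalityI subsetI)
    fix x assume x: "x \<in> ?L"
    then show "x \<in> ?R"
    proof (cases x)
      case (BaseE s'' e)
      then have "Stem t \<in> cends C (BaseE s'' e)" using x by simp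
      then show ?thesis by auto
    qed (auto simp: compound_graph_def doubleton_eq_iff)
  next
    fix x assume "x \<in> ?R"
    then show "x \<in> ?L" using assms by (auto simp: compound_graph_def split: if_splits)
  qed
  then show ?thesis unfolding biadjacency_def by simp
qed

text \<open>
  This lets the enumeration of the vertices of the compound graph start with one copy of the base
  graph.
\<close>

lemma bij_betw_extend_initial:
  fixes f :: "nat \<Rightarrow> 'a"
  assumes "finite B" "inj_on f {0..<n}" "f ` {0..<n} \<subseteq> B"
  obtains h where "bij_betw h {0..<card B} B" "\<And>i. i < n \<Longrightarrow> h i = f i" "n \<le> card B"
proof -
  have img: "card (f ` {0..<n}) = n" using assms(2) by (simp add: card_image)
  have n: "n \<le> card B" using card_mono[OF assms(1,3)] img by simp
  have "card {n..<card B} = card (B - f ` {0..<n})"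
    using assms img by (simp add: card_Diff_subset)
  then obtain g where g: "bij_betw g {n..<card B} (B - f ` {0..<n})"
    using finite_same_card_bij[of "{n..<card B}" "B - f ` {0..<n}"] assms(1) by auto
  define h where "h i = (if i < n then f i else g i)" for i
  have "bij_betw h {0..<n} (f ` {0..<n})"
    using assms(2) by (auto simp: bij_betw_def h_def inj_on_def)
  moreover have "bij_betw h {n..<card B} (B - f ` {0..<n})"
    using g by (rule bij_betw_cong[THEN iffD1, rotated]) (simp add: h_def)
  ultimately have "bij_betw h ({0..<n} \<union> {n..<card B}) (f ` {0..<n} \<union> (B - f ` {0..<n}))"
    by (rule bij_betw_combine) blast
  moreover have "{0..<n} \<union> {n..<card B} = {0..<card B}" using n by auto
  moreover have "f ` {0..<n} \<union> (B - f ` {0..<n}) = B" using assms(3) by blast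
  ultimately show thesis using that[of h] n by (simp add: h_def)
qed

text \<open>
  The coefficients of the column operation; they alternate because copies at adjacent vertices of
  the supergraph must cancel in the row of a stem.
\<close>

definition copy_sign :: "('v, 'e, 's, 'f, 't, 'l) compound \<Rightarrow> 's \<Rightarrow> 'r::comm_ring_1" where
  "copy_sign C s = (if s \<in> blacks (supergraph C) then 1 else - 1)"

lemma copy_sign_square: "copy_sign C s * copy_sign C s = 1"
  by (simp add: copy_sign_def)

lemma sum_copy_sign_stem:
  assumes "compound_data C" "t \<in> stems C"
  shows "(\<Sum>s\<in>ends (supergraph C) (stem_edge C t). copy_sign C s) = 0"
proof -
  have S: "finite_bigraph (supergraph C)" "stem_edge C t \<in> edges (supergraph C)"
    using assms by (simp_all add: compound_data_def)
  then obtain x y where "x \<in> blacks (supergraph C)" "y \<in> whites (supergraph C)"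
    "ends (supergraph C) (stem_edge C t) = {x, y}"
    unfolding finite_bigraph_def by blast
  moreover from this have "y \<notin> blacks (supergraph C)"
    using S(1) unfolding finite_bigraph_def by blast
  moreover from calculation have "x \<noteq> y" by blast
  ultimately show ?thesis by (simp add: copy_sign_def)
qed

section \<open>Divisibility for compound graphs\<close>

theorem theorem4p2:
  fixes C :: "('v, 'e, 's, 'f, 't, 'l) compound"
    and D :: "(('v, 's, 't, 'l) cvert, ('e, 's, 't, 'l) cedge) drawing"
    and w :: "'e \<Rightarrow> 'r::idom"
    and \<sigma> :: "('e, 's, 't, 'l) cedge \<Rightarrow> int"
  assumes "compound_data C"
    and "compound_drawing C D"
    and "\<sigma> \<in> respectful_signs C D"
  shows "matching_sum (base C) w dvd matching_sum (compound_graph C) (sign_weight \<sigma> w)"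
proof -
  let ?G = "base C" and ?H = "compound_graph C" and ?S = "verts (supergraph C)"
  have G: "finite_bigraph ?G" "card (blacks ?G) = card (whites ?G)"
    and S: "finite_bigraph (supergraph C)" "?S \<noteq> {}"
    using assms(1) by (simp_all add: compound_data_def)
  have D: "plane_drawing ?H D" using assms(2) by (simp add: compound_drawing_def)
  have \<sigma>: "sign_function ?H D \<sigma>" using assms(3) unfolding respectful_signs_def by blast
  have \<sigma>_eq: "\<sigma> (BaseE s e) = \<sigma> (BaseE s' e)" if "s \<in> ?S" "s' \<in> ?S" "e \<in> edges ?G" for s s' e
    using assms(3) that unfolding respectful_signs_def by blast
  have H: "finite_bigraph ?H" using assms(1) by (rule finite_bigraph_compound)
  obtain s0 where s0: "s0 \<in> ?S" using S(2) by blast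
  define n where "n = card (blacks ?G)"
  define N where "N = card (blacks ?H)"
  obtain gb where gb: "bij_betw gb {0..<n} (blacks ?G)"
    using ex_bij_betw_nat_finite[of "blacks ?G"] G(1) by (auto simp: n_def finite_bigraph_def)
  obtain gw where gw: "bij_betw gw {0..<n} (whites ?G)"
    using ex_bij_betw_nat_finite[of "whites ?G"] G by (auto simp: n_def finite_bigraph_def)
  have gbB: "gb i \<in> blacks ?G" and gwW: "gw i \<in> whites ?G" if "i < n" for i
    using gb gw that by (auto simp: bij_betw_def)
  have inj: "inj_on (\<lambda>i. BaseV s0 (gb i)) {0..<n}" "inj_on (\<lambda>i. BaseV s0 (gw i)) {0..<n}"
    using bij_betw_imp_inj_on[OF gb] bij_betw_imp_inj_on[OF gw]
    by (auto intro!: inj_onI dest: inj_onD)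
  have img: "(\<lambda>i. BaseV s0 (gb i)) ` {0..<n} \<subseteq> blacks ?H" "(\<lambda>i. BaseV s0 (gw i)) ` {0..<n} \<subseteq> whites ?H"
    using s0 gbB gwW by (auto simp: compound_blacks compound_whites)
  have finH: "finite (blacks ?H)" "finite (whites ?H)" using H by (simp_all add: finite_bigraph_def)
  obtain bs where bs: "bij_betw bs {0..<N} (blacks ?H)" "\<And>i. i < n \<Longrightarrow> bs i = BaseV s0 (gb i)"
    and nN: "n \<le> N"
    using bij_betw_extend_initial[OF finH(1) inj(1) img(1)] unfolding N_def by blast
  obtain ws where ws: "bij_betw ws {0..<N} (whites ?H)" "\<And>i. i < n \<Longrightarrow> ws i = BaseV s0 (gw i)"
    using bij_betw_extend_initial[OF finH(2) inj(2) img(2)]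
    unfolding N_def card_compound_blacks_whites[OF assms(1)] by blast
  interpret IG: indexed_bigraph ?G gb gw n by unfold_locales (fact G(1) gb gw)+
  interpret IH: indexed_bigraph ?H bs ws N by unfold_locales (fact H bs(1) ws(1))+

  \<comment> \<open>\<open>k\<close> and \<open>a\<close> are the signed matrices of \<open>H\<close> and \<open>G\<close>. The column of \<open>\<zeta>\<close> at a white base
    vertex \<open>u\<close> is the alternating combination of the copies of \<open>u\<close>. The factor \<open>copy_sign C s0\<close>
    makes the coefficient of the copy at \<open>s0\<close>, which is enumerated first, equal to 1. The same
    \<open>\<zeta>\<close>, read on black vertices, is the other factor of the product.\<close>
  define a where "a = biadjacency ?G (\<lambda>e. of_int (\<sigma> (BaseE s0 e)) * w e)"
  define k where "k = biadjacency ?H (\<lambda>x. of_int (\<sigma> x) * sign_weight \<sigma> w x)"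
  define \<epsilon> :: "'s \<Rightarrow> 'r" where "\<epsilon> s = copy_sign C s * copy_sign C s0" for s
  define \<zeta> where "\<zeta> x u = (case x of BaseV s v \<Rightarrow> if v = u then \<epsilon> s else 0 | _ \<Rightarrow> 0)"
    for x :: "('v, 's, 't, 'l) cvert" and u
  have k_base: "k (BaseV s b) (BaseV s' u) = (if s = s' then a b u else 0)"
    if "s \<in> ?S" for s s' b u
    using that \<sigma>_eq[OF that s0] unfolding k_def a_def biadjacency_base_base
    by (auto simp: sign_weight_def biadjacency_def intro!: sum.cong)
  have k_stem: "k (Stem t) (BaseV s u) =
      (if s \<in> ends (supergraph C) (stem_edge C t) \<and> u = stem_foot C t then 1 else 0)"
    if t: "t \<in> stems C" for t s u
  proof -
    \<comment> \<open>One sign comes from the sign-weighting, the other from the signed matrix.\<close>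
    have "of_int (\<sigma> (StemE t s)) * of_int (\<sigma> (StemE t s)) = (1::'r)"
      if "s \<in> ends (supergraph C) (stem_edge C t)"
    proof -
      have "StemE t s \<in> edges ?H" using t that by (auto simp: compound_graph_def)
      from sign_function_square[OF \<sigma> this] show ?thesis by (metis of_int_1 of_int_mult)
    qed
    then show ?thesis
      unfolding k_def biadjacency_stem_base[OF t] by (simp add: sign_weight_def)
  qed
  have sum_k: "(\<Sum>l<N. k x (ws l) * \<zeta> (ws l) u) = (\<Sum>s\<in>?S. k x (BaseV s u) * \<epsilon> s)"
    if u: "u \<in> whites ?G" for x u
  proof -
    have "(\<Sum>l<N. k x (ws l) * \<zeta> (ws l) u) = (\<Sum>y\<in>whites ?H. k x y * \<zeta> y u)"
      unfolding lessThan_atLeast0 by (rule sum.reindex_bij_betw[OF ws(1)])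
    also have "\<dots> = (\<Sum>y\<in>(\<lambda>s. BaseV s u) ` ?S. k x y * \<zeta> y u)"
      by (rule sum.mono_neutral_right)
        (use finH u in \<open>auto simp: compound_whites \<zeta>_def split: if_splits\<close>)
    also have "\<dots> = (\<Sum>s\<in>?S. k x (BaseV s u) * \<epsilon> s)"
      by (subst sum.reindex) (auto simp: inj_on_def \<zeta>_def)
    finally show ?thesis .
  qed
  have "Determinant.det (mat n n (\<lambda>(i, j). a (gb i) (gw j))) dvd
      Determinant.det (mat N N (\<lambda>(i, j). k (bs i) (ws j)))"
  proof (rule det_dvd_det_of_column_combination[OF nN])
    fix i j assume ij: "i < n" "j < n"
    then show "\<zeta> (ws i) (gw j) = (if i = j then 1 else 0)"
      by (simp add: \<zeta>_def ws(2) IG.ws_eq_iff \<epsilon>_def copy_sign_square)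
  next
    fix i j assume i: "i < N" and j: "j < n"
    have "bs i \<in> blacks ?H" using i bs(1) by (auto simp: bij_betw_def)
    then consider s b where "s \<in> ?S" "b \<in> blacks ?G" "bs i = BaseV s b"
      | t where "t \<in> stems C" "bs i = Stem t"
      by (auto simp: compound_blacks)
    then show "(\<Sum>l<N. k (bs i) (ws l) * \<zeta> (ws l) (gw j)) =
        (\<Sum>l<n. \<zeta> (bs i) (gb l) * a (gb l) (gw j))"
    proof cases
      case 1
      have "(\<Sum>l<N. k (bs i) (ws l) * \<zeta> (ws l) (gw j)) =
          (\<Sum>s'\<in>?S. if s = s' then a b (gw j) * \<epsilon> s else 0)"
        unfolding sum_k[OF gwW[OF j]] 1(3) by (rule sum.cong) (auto simp: k_base 1(1))
      also have "\<dots> = a b (gw j) * \<epsilon> s"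
        using 1(1) finite_bigraph_verts[OF S(1)] by simp
      also have "\<dots> = (\<Sum>b'\<in>blacks ?G. if b = b' then \<epsilon> s * a b (gw j) else 0)"
        using 1(2) G(1) by (simp add: finite_bigraph_def mult.commute)
      also have "\<dots> = (\<Sum>b'\<in>blacks ?G. \<zeta> (bs i) b' * a b' (gw j))"
        by (rule sum.cong) (auto simp: \<zeta>_def 1(3))
      also have "\<dots> = (\<Sum>l<n. \<zeta> (bs i) (gb l) * a (gb l) (gw j))"
        unfolding lessThan_atLeast0 by (rule sum.reindex_bij_betw[OF gb, symmetric])
      finally show ?thesis .
    next
      case 2
      \<comment> \<open>The two copies met by the stem have opposite coefficients.\<close>
      let ?e = "ends (supergraph C) (stem_edge C t)"
      have e: "?e \<subseteq> ?S"
        using finite_bigraph_ends_subset[OF S(1)] assms(1) 2(1) by (simp add: compound_data_def)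
      have "(\<Sum>l<N. k (bs i) (ws l) * \<zeta> (ws l) (gw j)) =
          (\<Sum>s\<in>?e. if gw j = stem_foot C t then \<epsilon> s else 0)"
        unfolding sum_k[OF gwW[OF j]] 2(2)
        using e finite_bigraph_verts[OF S(1)]
        by (intro sum.mono_neutral_cong_right) (auto simp: k_stem[OF 2(1)])
      also have "\<dots> = (if gw j = stem_foot C t then (\<Sum>s\<in>?e. copy_sign C s) * copy_sign C s0 else 0)"
        by (simp add: \<epsilon>_def sum_distrib_right)
      also have "\<dots> = 0" by (simp add: sum_copy_sign_stem[OF assms(1) 2(1)])
      finally show ?thesis by (simp add: 2(2) \<zeta>_def)
    qed
  qed
  moreover obtain c where "c * c = 1"
    "Determinant.det (mat n n (\<lambda>(i, j). a (gb i) (gw j))) = c * matching_sum ?G w"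
    using IG.det_eq_matching_sum[OF plane_drawing_copy[OF D s0 G(1)] sign_function_copy[OF assms(2) \<sigma> s0 G(1)], of w]
    unfolding a_def by blast
  moreover obtain d where d: "d * d = 1"
    "Determinant.det (mat N N (\<lambda>(i, j). k (bs i) (ws j))) = d * matching_sum ?H (sign_weight \<sigma> w)"
    using IH.det_eq_matching_sum[OF D \<sigma>, of "sign_weight \<sigma> w"] unfolding k_def by blast
  ultimately have "matching_sum ?G w dvd d * matching_sum ?H (sign_weight \<sigma> w)"
    by (metis dvd_mult_right)
  then have "matching_sum ?G w dvd d * (d * matching_sum ?H (sign_weight \<sigma> w))"
    by (rule dvd_mult)
  then show ?thesis using d(1) by (simp flip: mult.assoc)
qed

end
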